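(* Let $k$ be an algebraically closed field of characteristic zero. Let $f,g,h\in k(x)$ with $f(x)=g(h(x))$, $\deg g\ge 2$, $\deg h\geq 2$, and $g$ not of the shape $(\lambda(x))^m$ with $m\in\mathbb{N}$, $\lambda\in PGL_2(k)$. Suppose that $f$ has exactly $4$ zeros and poles altogether (in $k$) and that these form an arithmetic progression, i.e. the set of zeros and poles is $\{a,a+e,a+2e,a+3e\}$ for some $a,e\in k$ (with four distinct elements). Then $f$ is equivalent (in the sense defined in the context) to the rational function $$(x-\alpha_0)^{k_1}(x-\alpha_0-d)^{k_2}(x-\alpha_0-2d)^{k_2}(x-\alpha_0-3d)^{k_1}$$ for some $\alpha_0,d\in k$ and $k_1,k_2\in\mathbb{Z}$ with $k_1+k_2\neq 0$.
   Context: Equivalence: two rational functions $f_1(x)=\prod_{u=1}^n(x-\alpha_u^{(1)})^{f_u^{(1)}}$ and $f_2(x)=\prod_{u=1}^n(x-\alpha_u^{(2)})^{f_u^{(2)}}$ (with integer exponents, the zeros and poles being listed in some order) are equivalent if there exist $a_{u,v}\in\mathbb{Q}$, $u\in\{1,\ldots,n\}$, $v\in\{1,\ldots,n+1\}$, such that $$\alpha_u^{(1)}=a_{u,1}\alpha_1^{(2)}+a_{u,2}\alpha_2^{(2)}+\cdots+a_{u,n}\alpha_n^{(2)}+a_{u,n+1}$$ for all $u\in\{1,\ldots,n\}$. A nonzero constant factor of a rational function is disregarded: $c\prod_u(x-\alpha_u)^{f_u}$ with $c\in k\setminus\{0\}$ is treated as $\prod_u(x-\alpha_u)^{f_u}$.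 Here $n=4$. The degree of a rational function $p/q$ with $p,q$ coprime polynomials is $\max(\deg p,\deg q)$. An element $\lambda\in PGL_2(k)$ is viewed as the fractional linear function $\lambda(x)=\frac{ax+b}{cx+e}$ with $ae-bc\ne 0$. *)

theory Defs
  imports "HOL-Computational_Algebra.Computational_Algebra"
begin

text \<open>
  The rational function field k(x) is the fraction field \<open>'a poly fract\<close>. The library function
  \<open>quot_of_fract\<close> would force the type class \<open>field_gcd\<close> on the ground field, so fractions in
  lowest terms are described by a relation instead. Numerator and denominator are unique up to a
  common nonzero constant, and everything below is invariant under that ambiguity.
\<close>

definition lowest_terms :: "'a::field poly fract \<Rightarrow> 'a poly \<Rightarrow> 'a poly \<Rightarrow> bool" where
  "lowest_terms f p q \<longleftrightarrow> q \<noteq> 0 \<and> coprime p q \<and> f = Fract p q"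

definition rat_degree :: "'a::field poly fract \<Rightarrow> nat" where
  "rat_degree f = (THE d. \<exists>p q. lowest_terms f p q \<and> d = max (degree p) (degree q))"

text \<open>Zeros and poles are those in the ground field; the point at infinity is never included.\<close>

definition rat_zeros :: "'a::field poly fract \<Rightarrow> 'a set" where
  "rat_zeros f = {x. \<exists>p q. lowest_terms f p q \<and> poly p x = 0}"

definition rat_poles :: "'a::field poly fract \<Rightarrow> 'a set" where
  "rat_poles f = {x. \<exists>p q. lowest_terms f p q \<and> poly q x = 0}"

definition rat_const :: "'a::field \<Rightarrow> 'a poly fract" where
  "rat_const c = Fract [:c:] 1"

definition poly_at_rat :: "'a::field poly \<Rightarrow> 'a poly fract \<Rightarrow> 'a poly fract" where
  "poly_at_rat p h = poly (map_poly rat_const p) h"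

text \<open>
  \<open>rat_compose g h\<close> is g(h(x)). For nonconstant \<open>h\<close> the denominator never vanishes; only for a
  constant \<open>h\<close> equal to a pole of \<open>g\<close> does the convention for division by zero matter.
\<close>

definition rat_compose :: "'a::field poly fract \<Rightarrow> 'a poly fract \<Rightarrow> 'a poly fract" where
  "rat_compose g h =
     (THE r. \<exists>p q. lowest_terms g p q \<and> r = poly_at_rat p h / poly_at_rat q h)"

definition linear_factor :: "'a::field \<Rightarrow> 'a poly fract" where
  "linear_factor \<alpha> = Fract [:-\<alpha>, 1:] 1"

definition fractional_linear :: "'a::field poly fract \<Rightarrow> bool" where
  "fractional_linear l \<longleftrightarrow>
     (\<exists>a b c e. a * e - b * c \<noteq> 0 \<and> l = Fract [:b, a:] [:e, c:])"

text \<open>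
  \<open>factorization n f \<alpha> m\<close>: up to a nonzero constant factor, \<open>f\<close> is the product of the
  (x - \<alpha> u)^(m u) for u = 1, ..., n, where \<open>\<alpha> 1, \<dots>, \<alpha> n\<close> enumerate the zeros and poles of
  \<open>f\<close> without repetition (so each exponent is nonzero).
\<close>

definition factorization ::
    "nat \<Rightarrow> 'a::field poly fract \<Rightarrow> (nat \<Rightarrow> 'a) \<Rightarrow> (nat \<Rightarrow> int) \<Rightarrow> bool" where
  "factorization n f \<alpha> m \<longleftrightarrow>
     inj_on \<alpha> {1..n} \<and> (\<forall>u\<in>{1..n}. m u \<noteq> 0) \<and>
     (\<exists>c. c \<noteq> 0 \<and> f = rat_const c * (\<Prod>u=1..n. linear_factor (\<alpha> u) powi m u))"

text \<open>
  Equivalence of rational functions with \<open>n\<close> zeros and poles each, for some order of the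
  zeros and poles. Corresponding factors carry the same exponent \<open>m u\<close>: without this the exponents
  would play no role, and any two functions with the same set of zeros and poles
  would be equivalent.
\<close>

definition equivalent ::
    "nat \<Rightarrow> 'a::field_char_0 poly fract \<Rightarrow> 'a poly fract \<Rightarrow> bool" where
  "equivalent n f1 f2 \<longleftrightarrow>
     (\<exists>\<alpha>1 \<alpha>2 m. factorization n f1 \<alpha>1 m \<and> factorization n f2 \<alpha>2 m \<and>
       (\<exists>a :: nat \<Rightarrow> nat \<Rightarrow> rat. \<forall>u\<in>{1..n}.
          \<alpha>1 u = (\<Sum>v=1..n. of_rat (a u v) * \<alpha>2 v) + of_rat (a u (n + 1))))"


text \<open>The notions defined through \<open>lowest_terms\<close> do not depend on the representation chosen.\<close>

lemma lowest_terms_exists: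
  fixes f :: "'a::field poly fract"
  shows "\<exists>p q. lowest_terms f p q"
proof -
  define P where "P = (\<lambda>(p, q). q \<noteq> 0 \<and> f = Fract p q)"
  obtain p0 q0 where "P (p0, q0)"
    unfolding P_def by (cases f) auto
  then obtain pq where pq: "P pq" and min: "\<And>y. P y \<Longrightarrow> degree (snd pq) \<le> degree (snd y)"
    using ex_has_least_nat[of P "(p0, q0)" "\<lambda>y. degree (snd y)"] by blast
  obtain p q where [simp]: "pq = (p, q)" by (cases pq)
  have q: "q \<noteq> 0" and f: "f = Fract p q" using pq by (auto simp: P_def)
  have "coprime p q"
  proof (rule coprimeI)
    fix d assume "d dvd p" "d dvd q"
    then obtain p' q' where p': "p = d * p'" and q': "q = d * q'" by (auto elim!: dvdE)
    have nz: "d \<noteq> 0" "q' \<noteq> 0" using q q' by auto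
    have "f = Fract p' q'" using f nz p' q' by (simp add: eq_fract)
    then have "degree q \<le> degree q'" using min[of "(p', q')"] nz by (auto simp: P_def)
    moreover have "degree q = degree d + degree q'" using nz q' by (simp add: degree_mult_eq)
    ultimately have "degree d = 0" by simp
    then show "is_unit d" using nz(1) by (simp add: is_unit_iff_degree)
  qed
  then show ?thesis using q f unfolding lowest_terms_def by blast
qed

lemma coprime_poly_dvd_mult:
  fixes p q r :: "'a::field poly"
  assumes cop: "coprime p q" and "q \<noteq> 0" and dvd: "q dvd p * r"
  shows "q dvd r"
proof -
  define P where "P = (\<lambda>d. d \<noteq> 0 \<and> (\<exists>a b. d = a * p + b * q))"
  have "P q" unfolding P_def using assms(2) by (metis add_0 mult_1 mult_zero_left)
  then obtain d where d: "P d" and min: "\<And>y. P y \<Longrightarrow> degree d \<le> degree y"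
    using ex_has_least_nat[of P q degree] by blast
  obtain a b where ab: "d = a * p + b * q" and nz: "d \<noteq> 0" using d by (auto simp: P_def)
  have dvd_comb: "d dvd s" if s: "s = x * p + y * q" for s x y
  proof (rule ccontr)
    assume "\<not> d dvd s"
    then have m: "s mod d \<noteq> 0" by (simp add: dvd_eq_mod_eq_0)
    have "s mod d = (x - s div d * a) * p + (y - s div d * b) * q"
    proof -
      have "s mod d = s - s div d * d" by (rule minus_div_mult_eq_mod [symmetric])
      also have "\<dots> = (x * p + y * q) - s div d * (a * p + b * q)"
        using s ab by metis
      also have "\<dots> = (x - s div d * a) * p + (y - s div d * b) * q"
        by (simp add: algebra_simps)
      finally show ?thesis .
    qed
    then have "P (s mod d)" using m unfolding P_def by blast
    then have "degree d \<le> degree (s mod d)" by (rule min)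
    then show False using degree_mod_less[OF nz, of s] m by auto
  qed
  have "d dvd p" using dvd_comb[of p 1 0] by simp
  moreover have "d dvd q" using dvd_comb[of q 0 1] by simp
  ultimately have "is_unit d" using cop by (metis coprime_common_divisor)
  have "d * r = a * (p * r) + q * (b * r)" using ab by (simp add: algebra_simps)
  then have "q dvd d * r" using dvd by simp
  then show ?thesis using \<open>is_unit d\<close> by (simp add: dvd_mult_unit_iff')
qed

lemma lowest_terms_unique:
  fixes f :: "'a::field poly fract"
  assumes "lowest_terms f p q" "lowest_terms f p' q'"
  shows "\<exists>c. c \<noteq> 0 \<and> p' = smult c p \<and> q' = smult c q"
proof -
  have nz: "q \<noteq> 0" "q' \<noteq> 0" and cop: "coprime p q" "coprime p' q'"
    and eq: "p * q' = p' * q"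
    using assms by (auto simp: lowest_terms_def eq_fract)
  have "q dvd p * q'" "q' dvd p' * q" using eq by (metis dvd_triv_right)+
  then have dvd: "q dvd q'" "q' dvd q"
    using coprime_poly_dvd_mult[OF cop(1) nz(1)] coprime_poly_dvd_mult[OF cop(2) nz(2)] by blast+
  then obtain r where r: "q' = q * r" by (auto elim: dvdE)
  have "is_unit r" using dvd(2) nz r by simp
  then obtain c where c: "r = [:c:]" "c \<noteq> 0" by (force simp: is_unit_poly_iff)
  have q': "q' = smult c q" using r c by simp
  have "p' * q = smult c p * q" using eq q' by simp
  then have "p' = smult c p" using nz mult_right_cancel by blast
  then show ?thesis using q' c by blast
qed

lemma rat_degree_eq:
  assumes "lowest_terms f p q"
  shows "rat_degree f = max (degree p) (degree q)"
  unfolding rat_degree_def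
proof (rule the_equality)
  fix d assume "\<exists>p q. lowest_terms f p q \<and> d = max (degree p) (degree q)"
  then show "d = max (degree p) (degree q)"
    using lowest_terms_unique[OF assms] by (metis degree_smult_eq)
qed (use assms in blast)

lemma rat_zeros_eq:
  assumes "lowest_terms f p q"
  shows "rat_zeros f = {x. poly p x = 0}"
  using assms lowest_terms_unique[OF assms] unfolding rat_zeros_def by fastforce

lemma rat_poles_eq:
  assumes "lowest_terms f p q"
  shows "rat_poles f = {x. poly q x = 0}"
  using assms lowest_terms_unique[OF assms] unfolding rat_poles_def by fastforce

lemma rat_const_0 [simp]: "rat_const 0 = 0"
  by (simp add: rat_const_def Zero_fract_def)

lemma rat_const_eq_0_iff [simp]: "rat_const c = 0 \<longleftrightarrow> c = 0"
  by (simp add: rat_const_def Zero_fract_def eq_fract)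

lemma poly_at_rat_smult: "poly_at_rat (smult c p) h = rat_const c * poly_at_rat p h"
proof -
  have "map_poly rat_const (smult c p) = smult (rat_const c) (map_poly rat_const p)"
    by (rule poly_eqI) (simp add: coeff_map_poly, simp add: rat_const_def mult.commute)
  then show ?thesis by (simp add: poly_at_rat_def)
qed

lemma rat_compose_eq:
  assumes "lowest_terms g p q"
  shows "rat_compose g h = poly_at_rat p h / poly_at_rat q h"
  unfolding rat_compose_def
proof (rule the_equality)
  fix r assume "\<exists>p q. lowest_terms g p q \<and> r = poly_at_rat p h / poly_at_rat q h"
  then obtain p' q' where "lowest_terms g p' q'" and r: "r = poly_at_rat p' h / poly_at_rat q' h"
    by blast
  then obtain c where "c \<noteq> 0" "p' = smult c p" "q' = smult c q"
    using lowest_terms_unique[OF assms] by blast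
  then show "r = poly_at_rat p h / poly_at_rat q h"
    using r by (simp add: poly_at_rat_smult)
qed (use assms in blast)

end

theory Submission
  imports Defs
begin

text \<open>
  Write h = p/q. A point s of the projective line with homogeneous coordinates (u, v), representing
  v/u, has as finite preimages under h the roots of \<open>A s = u p - v q\<close>, and f is up to a constant
  the product of the \<open>A s ^ m s\<close> over the zeros and poles s of g on the projective line, where the
  m s sum to 0. As g is not a power of a fractional linear function, there are at least three such s.

  Let D be the product of the x - \<rho> over the four zeros and poles \<rho> of f. For two of the points
  the Wronskian satisfies \<open>D (A' B - A B') = A B Z\<close> with \<open>deg Z \<le> 3\<close>, and Z is divisible by every
  other A s. At most one A s has degree less than N = deg h, so there are exactly three points
  and \<open>N \<le> 3\<close>. What is left is a finite problem: three linearly dependent polynomials of degree at most 3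
  with disjoint root sets covering an arithmetic progression of length 4. Integer determinants
  rule out all multiplicity patterns except N = 2 with one A s constant, one vanishing at the
  two outer points and one at the two inner points. Hence f already has the required form.
\<close>

subsection \<open>Divisibility and the Wronskian\<close>

text \<open>A root of multiplicity k of \<open>A\<close> is a root of \<open>pderiv A\<close> of
  multiplicity at least k - 1, and \<open>D\<close> supplies the missing linear factor. The
  induction splits off one root at a time.\<close>

lemma pderiv_mult_dvd:
  fixes A D :: "'a::alg_closed_field poly"
  assumes "A \<noteq> 0" "\<And>x. poly A x = 0 \<Longrightarrow> poly D x = 0"
  shows "A dvd D * pderiv A"
  using assms
proof (induction "degree A" arbitrary: A)
  case 0
  then have "is_unit A" by (simp add: is_unit_iff_degree)
  then show ?case by (rule unit_imp_dvd)
next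
  case (Suc n)
  then obtain r where r: "poly A r = 0" using alg_closed_imp_poly_has_root[of A] by auto
  then obtain B where B: "A = [:-r, 1:] * B" by (auto simp: poly_eq_0_iff_dvd elim: dvdE)
  have "B \<noteq> 0" using Suc.prems B by auto
  then have "n = degree B" using Suc.hyps(2) B degree_mult_eq[of "[:-r,1:]" B] by simp
  then have dB: "B dvd D * pderiv B" using Suc \<open>B \<noteq> 0\<close> B by auto
  have "[:-r, 1:] dvd D" using Suc.prems(2) r by (simp add: poly_eq_0_iff_dvd)
  then have "[:-r, 1:] * B dvd D * B" by (rule mult_dvd_mono) simp
  moreover have "[:-r, 1:] * B dvd [:-r, 1:] * (D * pderiv B)" using dB by (intro mult_dvd_mono) auto
  moreover have "D * pderiv A = D * B + [:-r, 1:] * (D * pderiv B)"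
    unfolding B by (simp only: pderiv_mult) (simp add: pderiv_pCons algebra_simps)
  ultimately show ?case using B by (metis dvd_add)
qed

text \<open>\<open>X\<close> may exceed the root set, with exponent 0 at the extra points, so that
  two polynomials can be factored over one index set.\<close>

lemma poly_splits_on:
  fixes A :: "'a::alg_closed_field poly"
  assumes "A \<noteq> 0" "finite X" "\<And>x. poly A x = 0 \<Longrightarrow> x \<in> X"
  shows "\<exists>k c. c \<noteq> 0 \<and> A = smult c (\<Prod>x\<in>X. [:-x, 1:] ^ k x)"
  using assms
proof (induction "degree A" arbitrary: A)
  case 0
  then obtain c where "A = [:c:]" using degree_eq_zeroE by metis
  with 0 show ?case by (intro exI[of _ "\<lambda>_. 0"] exI[of _ c]) auto
next
  case (Suc n)
  then obtain r where r: "poly A r = 0" using alg_closed_imp_poly_has_root[of A] by auto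
  then obtain B where B: "A = [:-r, 1:] * B" by (auto simp: poly_eq_0_iff_dvd elim: dvdE)
  have "B \<noteq> 0" using Suc.prems B by auto
  then have "n = degree B" using Suc.hyps(2) B degree_mult_eq[of "[:-r,1:]" B] by simp
  then obtain k c where kc: "c \<noteq> 0" "B = smult c (\<Prod>x\<in>X. [:-x, 1:] ^ k x)"
    using Suc.hyps(1)[of B] Suc.prems \<open>B \<noteq> 0\<close> B by auto
  have rX: "r \<in> X" using Suc r by auto
  have "(\<Prod>x\<in>X. [:-x, 1:] ^ (k(r := Suc (k r))) x)
        = [:-r, 1:] ^ Suc (k r) * (\<Prod>x\<in>X - {r}. [:-x, 1:] ^ k x)"
    using rX Suc.prems(2) by (simp add: prod.remove[of X r])
  moreover have "(\<Prod>x\<in>X. [:-x, 1:] ^ k x) = [:-r, 1:] ^ k r * (\<Prod>x\<in>X - {r}. [:-x, 1:] ^ k x)"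
    using rX Suc.prems(2) by (simp add: prod.remove[of X r])
  ultimately have "A = smult c (\<Prod>x\<in>X. [:-x, 1:] ^ (k(r := Suc (k r))) x)"
    unfolding B kc(2) by (simp only: power_Suc mult_smult_right mult.assoc)
  then show ?case using kc(1) by blast
qed

lemma coprime_iff_no_common_root:
  fixes p q :: "'a::alg_closed_field poly"
  shows "coprime p q \<longleftrightarrow> \<not> (\<exists>x. poly p x = 0 \<and> poly q x = 0)"
proof
  assume "coprime p q"
  show "\<not> (\<exists>x. poly p x = 0 \<and> poly q x = 0)"
  proof
    assume "\<exists>x. poly p x = 0 \<and> poly q x = 0"
    then obtain x where "[:-x, 1:] dvd p" "[:-x, 1:] dvd q" by (auto simp: poly_eq_0_iff_dvd)
    then have "is_unit [:-x, 1:]" using \<open>coprime p q\<close> coprime_common_divisor by blast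
    then show False by (simp add: is_unit_iff_degree)
  qed
next
  assume nc: "\<not> (\<exists>x. poly p x = 0 \<and> poly q x = 0)"
  show "coprime p q"
  proof (rule coprimeI)
    fix d assume d: "d dvd p" "d dvd q"
    have "d \<noteq> 0" using d nc by force
    moreover have "degree d = 0"
    proof (rule ccontr)
      assume "degree d \<noteq> 0"
      then obtain x where "poly d x = 0" using alg_closed_imp_poly_has_root[of d] by auto
      then show False using d nc by (metis dvd_trans poly_eq_0_iff_dvd)
    qed
    ultimately show "is_unit d" by (simp add: is_unit_iff_degree)
  qed
qed

lemma coprime_mult_dvd:
  fixes A B E :: "'a::field poly"
  assumes "coprime A B" "B \<noteq> 0" "A dvd E" "B dvd E"
  shows "A * B dvd E"
proof -
  obtain r where r: "E = A * r" using assms by (auto elim: dvdE)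
  then have "B dvd r" using assms coprime_poly_dvd_mult by blast
  then show ?thesis using r by simp
qed

lemma dvd_pderiv_imp_constant:
  fixes A :: "'a::field_char_0 poly"
  assumes "A dvd pderiv A"
  shows "degree A = 0"
proof (rule ccontr)
  assume "degree A \<noteq> 0"
  then have "pderiv A \<noteq> 0" by (simp add: pderiv_eq_0_iff)
  then have "degree A \<le> degree (pderiv A)" using assms dvd_imp_degree_le by blast
  then show False using \<open>degree A \<noteq> 0\<close> by (simp add: degree_pderiv)
qed

text \<open>If the Wronskian vanished, coprimality would make each polynomial divide its own
  derivative, and in characteristic zero both would be constant.\<close>

lemma wronskian_nonzero:
  fixes A B :: "'a::field_char_0 poly"
  assumes "coprime A B" "A \<noteq> 0" "B \<noteq> 0" "degree A > 0 \<or> degree B > 0"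
  shows "pderiv A * B \<noteq> A * pderiv B"
proof
  assume eq: "pderiv A * B = A * pderiv B"
  have eq': "B * pderiv A = A * pderiv B" using eq by (simp only: mult.commute)
  have "coprime B A" using assms(1) by (simp only: coprime_commute)
  moreover have "A dvd B * pderiv A" unfolding eq' by (rule dvd_triv_left)
  ultimately have "A dvd pderiv A" using assms(2) coprime_poly_dvd_mult by blast
  have "B dvd A * pderiv B" unfolding eq'[symmetric] by (rule dvd_triv_left)
  then have "B dvd pderiv B" using assms(1,3) coprime_poly_dvd_mult by blast
  then have "degree B = 0" by (rule dvd_pderiv_imp_constant)
  moreover have "degree A = 0" using \<open>A dvd pderiv A\<close> by (rule dvd_pderiv_imp_constant)
  ultimately show False using assms(4) by simp
qed

text \<open>\<open>U\<close> is \<open>D\<close> times the logarithmic derivative of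
  \<open>A\<close>, and differentiation lowers the degree.\<close>

lemma degree_pderiv_cofactor:
  fixes A D U :: "'a::field_char_0 poly"
  assumes "A \<noteq> 0" "degree D > 0" "D * pderiv A = A * U"
  shows "degree U < degree D"
proof (cases "U = 0")
  case False
  then have nz: "pderiv A \<noteq> 0" "D \<noteq> 0" using assms by auto
  then have "degree A > 0" by (simp add: pderiv_eq_0_iff)
  moreover have "degree D + degree (pderiv A) = degree A + degree U"
    using assms nz False by (metis degree_mult_eq)
  ultimately show ?thesis by (simp add: degree_pderiv)
qed (use assms in auto)

text \<open>The logarithmic derivatives of \<open>A\<close> and \<open>B\<close>, multiplied by
  \<open>D\<close>, are polynomials \<open>U\<close> and \<open>V\<close>, and \<open>Z\<close> is
  their difference. It depends on \<open>A\<close> and \<open>B\<close> alone, so a single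
  \<open>Z\<close> serves every combination \<open>C\<close>.\<close>

lemma wronskian_cofactor:
  fixes A B D :: "'a::{alg_closed_field, field_char_0} poly"
  assumes "coprime A B" "A \<noteq> 0" "B \<noteq> 0" "degree A > 0 \<or> degree B > 0" "degree D > 0"
    and roots: "\<And>x. poly A x = 0 \<Longrightarrow> poly D x = 0" "\<And>x. poly B x = 0 \<Longrightarrow> poly D x = 0"
  obtains Z where "Z \<noteq> 0" "degree Z < degree D"
    "\<And>C a b. C = smult a A + smult b B \<Longrightarrow> a \<noteq> 0 \<Longrightarrow> b \<noteq> 0 \<Longrightarrow> C \<noteq> 0 \<Longrightarrow>
       (\<And>x. poly C x = 0 \<Longrightarrow> poly D x = 0) \<Longrightarrow> C dvd Z"
proof -
  have "A dvd D * pderiv A" "B dvd D * pderiv B"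
    using pderiv_mult_dvd assms(2,3) roots by blast+
  then obtain U V where U: "D * pderiv A = A * U" and V: "D * pderiv B = B * V"
    by (auto elim!: dvdE)
  have "D * (pderiv A * B - A * pderiv B) = (D * pderiv A) * B - A * (D * pderiv B)"
    by (simp add: algebra_simps)
  also have "\<dots> = A * (B * (U - V))"
    unfolding U V by (simp add: algebra_simps)
  finally have eq: "D * (pderiv A * B - A * pderiv B) = A * (B * (U - V))" .
  have "D \<noteq> 0" using assms(5) by auto
  then have "U - V \<noteq> 0" using eq wronskian_nonzero[OF assms(1-4)] by auto
  moreover have "degree (U - V) < degree D"
    using degree_pderiv_cofactor[OF assms(2) assms(5) U] degree_pderiv_cofactor[OF assms(3) assms(5) V]
    by (rule degree_diff_less)
  moreover have "C dvd U - V" if C: "C = smult a A + smult b B" "a \<noteq> 0" "b \<noteq> 0" "C \<noteq> 0"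
    "\<And>x. poly C x = 0 \<Longrightarrow> poly D x = 0" for C a b
  proof -
    have cop: "coprime A C" "coprime B C"
      using assms(1) C(2,3) unfolding coprime_iff_no_common_root C(1) by (simp_all, blast)
    have "C dvd D * pderiv C" using C(4,5) by (rule pderiv_mult_dvd)
    \<comment> \<open>Replacing \<open>A\<close> by \<open>C\<close> in the Wronskian with
      \<open>B\<close> only multiplies it by \<open>a\<close>, since the contribution of
      \<open>B\<close> cancels.\<close>
    then have "C dvd (D * pderiv C) * B - C * (D * pderiv B)" by simp
    also have "(D * pderiv C) * B - C * (D * pderiv B) = smult a (D * (pderiv A * B - A * pderiv B))"
      unfolding C(1) by (simp add: pderiv_add pderiv_smult algebra_simps smult_diff_right)
    finally have "C dvd D * (pderiv A * B - A * pderiv B)" using C(2) by (rule dvd_smult_cancel)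
    then have "C dvd A * (B * (U - V))" unfolding eq .
    then show ?thesis
      using coprime_poly_dvd_mult[OF cop(1) C(4)] coprime_poly_dvd_mult[OF cop(2) C(4)] by blast
  qed
  ultimately show ?thesis by (rule that)
qed

subsection \<open>Multiplicity patterns on an arithmetic progression\<close>

text \<open>The affine map sending a + i e to i turns the progression into 0, 1, 2, 3; this is the
  value at x of the monic polynomial with root multiplicities \<open>k\<close> there. Integer values
  make the later case check computable.\<close>

definition ap_value :: "nat list \<Rightarrow> int \<Rightarrow> int" where
  "ap_value k x = x ^ (k ! 0) * (x - 1) ^ (k ! 1) * (x - 2) ^ (k ! 2) * (x - 3) ^ (k ! 3)"

definition det3 :: "int \<times> int \<times> int \<Rightarrow> int \<times> int \<times> int \<Rightarrow> int \<times> int \<times> int \<Rightarrow> int" where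
  "det3 = (\<lambda>(a1, a2, a3) (b1, b2, b3) (c1, c2, c3).
     a1 * (b2 * c3 - b3 * c2) - a2 * (b1 * c3 - b3 * c1) + a3 * (b1 * c2 - b2 * c1))"

text \<open>
  For polynomials of degree at most 3 with roots in {0, 1, 2, 3}, dependence means that the
  matrix of values at 0, ..., 3 has vanishing 3 x 3 minors.
\<close>

definition ap_dependent :: "nat list \<Rightarrow> nat list \<Rightarrow> nat list \<Rightarrow> bool" where
  "ap_dependent k l m \<longleftrightarrow>
     (let v = (\<lambda>x. (ap_value k x, ap_value l x, ap_value m x)) in
       det3 (v 0) (v 1) (v 2) = 0 \<and> det3 (v 0) (v 1) (v 3) = 0 \<and>
       det3 (v 0) (v 2) (v 3) = 0 \<and> det3 (v 1) (v 2) (v 3) = 0)"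

definition disjoint_exps :: "nat list \<Rightarrow> nat list \<Rightarrow> bool" where
  "disjoint_exps k l \<longleftrightarrow> list_all2 (\<lambda>i j. i = 0 \<or> j = 0) k l"

text \<open>Together with \<open>disjoint_exps k l\<close> this says that each of the four points is
  a root of exactly one of the three polynomials.\<close>

definition partition_exps :: "nat list \<Rightarrow> nat list \<Rightarrow> nat list \<Rightarrow> bool" where
  "partition_exps k l m \<longleftrightarrow>
     list_all2 (\<lambda>i j. (i = 0) = (j > 0)) (map2 (+) k l) m"

fun exps :: "nat \<Rightarrow> nat \<Rightarrow> nat list list" where
  "exps 0 s = [[]]"
| "exps (Suc n) s = concat (map (\<lambda>i. map (Cons i) (exps n (s - i))) [0..<Suc s])"

lemma set_exps: "set (exps n s) = {k. length k = n \<and> sum_list k \<le> s}"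
proof (induction n arbitrary: s)
  case (Suc n)
  have "k \<in> set (exps (Suc n) s) \<longleftrightarrow> length k = Suc n \<and> sum_list k \<le> s" for k
  proof (cases k)
    case (Cons i k')
    then show ?thesis using Suc by (auto simp: image_iff simp del: upt_Suc intro!: bexI[of _ i])
  qed (auto simp del: upt_Suc)
  then show ?case by (intro set_eqI) (simp only: mem_Collect_eq)
qed auto

text \<open>
  The predicates below are named one by one, without abstractions over the enumerated lists:
  otherwise the simplifier evaluates the loop bodies under their binders, where nothing can be
  filtered out yet.
\<close>

definition ap_pattern_ok :: "nat list \<Rightarrow> nat list \<Rightarrow> nat list \<Rightarrow> bool" where
  "ap_pattern_ok k l m \<longleftrightarrow> m = [0, 0, 0, 0] \<and>
     (k = [1, 0, 0, 1] \<and> l = [0, 1, 1, 0] \<or> k = [0, 1, 1, 0] \<and> l = [1, 0, 0, 1]) \<or>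
     \<not> ap_dependent k l m"

definition ap_patterns_ok_two :: "nat list list \<Rightarrow> nat list \<Rightarrow> nat list \<Rightarrow> bool" where
  "ap_patterns_ok_two ms k l = list_all (ap_pattern_ok k l) (filter (partition_exps k l) ms)"

definition ap_patterns_ok_first :: "nat list list \<Rightarrow> nat list list \<Rightarrow> nat list \<Rightarrow> bool" where
  "ap_patterns_ok_first ls ms k = list_all (ap_patterns_ok_two ms k) (filter (disjoint_exps k) ls)"

definition ap_patterns_ok :: "nat list list \<Rightarrow> nat list list \<Rightarrow> bool" where
  "ap_patterns_ok ls ms = list_all (ap_patterns_ok_first ls ms) ls"

definition sum_eq :: "nat \<Rightarrow> nat list \<Rightarrow> bool" where
  "sum_eq N k \<longleftrightarrow> sum_list k = N"

text \<open>The first list serves the two polynomials of full degree; the third may have smaller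
  degree and ranges over all patterns of sum at most 2.\<close>

lemma ap_patterns_degree_2:
  "ap_patterns_ok (filter (sum_eq 2) (exps 4 2)) (exps 4 2)"
  by code_simp

lemma ap_patterns_degree_3:
  "ap_patterns_ok (filter (sum_eq 3) (exps 4 3)) (exps 4 3)"
  by code_simp

section \<open>Polynomials with all roots in an arithmetic progression\<close>

definition ap_poly :: "'a::field_char_0 \<Rightarrow> 'a \<Rightarrow> nat list \<Rightarrow> 'a poly" where
  "ap_poly a e k = [:-a, 1:] ^ (k ! 0) * [:-(a + e), 1:] ^ (k ! 1) *
     [:-(a + 2 * e), 1:] ^ (k ! 2) * [:-(a + 3 * e), 1:] ^ (k ! 3)"

text \<open>Each linear factor contributes one factor e, so up to a nonzero scalar common to all
  points the values are integers.\<close>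

lemma poly_ap_poly:
  assumes "length k = 4"
  shows "poly (ap_poly a e k) (a + of_int x * e) = e ^ sum_list k * of_int (ap_value k x)"
proof -
  obtain k0 k1 k2 k3 where k: "k = [k0, k1, k2, k3]"
    using assms by (auto simp: length_Suc_conv numeral_eq_Suc)
  have *: "- a + (a + of_int x * e) = of_int x * e"
    "- (a + e) + (a + of_int x * e) = of_int (x - 1) * e"
    "- (a + 2 * e) + (a + of_int x * e) = of_int (x - 2) * e"
    "- (a + 3 * e) + (a + of_int x * e) = of_int (x - 3) * e"
    by (simp_all add: algebra_simps)
  show ?thesis
    unfolding ap_poly_def ap_value_def k poly_mult poly_power poly_pCons poly_0 mult_zero_right
      add_0_right mult_1_right *
    by (simp add: power_mult_distrib power_add)
qed

lemma degree_ap_poly: "length k = 4 \<Longrightarrow> degree (ap_poly a e k) = sum_list k"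
  by (auto simp: ap_poly_def degree_mult_eq degree_power_eq length_Suc_conv numeral_eq_Suc)

lemma ap_poly_eq_0_iff:
  assumes "length k = 4" "e \<noteq> 0" "x \<in> {0, 1, 2, 3}"
  shows "poly (ap_poly a e k) (a + of_nat x * e) = 0 \<longleftrightarrow> k ! x > 0"
  using assms by (auto simp: ap_poly_def)

lemma ap_poly_exists:
  fixes A :: "'a::{alg_closed_field, field_char_0} poly"
  assumes "A \<noteq> 0" "e \<noteq> 0" "{x. poly A x = 0} \<subseteq> {a, a + e, a + 2 * e, a + 3 * e}"
  obtains c k where "c \<noteq> 0" "length k = 4" "A = smult c (ap_poly a e k)"
proof -
  obtain k c where kc: "c \<noteq> 0"
    "A = smult c (\<Prod>x\<in>{a, a + e, a + 2 * e, a + 3 * e}. [:-x, 1:] ^ k x)"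
    using poly_splits_on[of A "{a, a + e, a + 2 * e, a + 3 * e}"] assms by auto
  have "a + e \<noteq> a + 2 * e" "a + e \<noteq> a + 3 * e" "a + 2 * e \<noteq> a + 3 * e"
    using assms(2) by auto
  then have "A = smult c (ap_poly a e [k a, k (a + e), k (a + 2 * e), k (a + 3 * e)])"
    using assms(2) unfolding kc(2) by (simp add: ap_poly_def mult.assoc)
  with kc(1) that show ?thesis by force
qed

text \<open>The vector (a, b, c) lies in the kernel of the matrix, and Cramer's rule gives a times
  the determinant equal to 0.\<close>

lemma linear_dependence_det3:
  fixes a b c :: "'a::field_char_0"
  assumes "a \<noteq> 0"
    and "a * of_int x1 + b * of_int y1 + c * of_int z1 = 0"
    and "a * of_int x2 + b * of_int y2 + c * of_int z2 = 0"
    and "a * of_int x3 + b * of_int y3 + c * of_int z3 = 0"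
  shows "det3 (x1, y1, z1) (x2, y2, z2) (x3, y3, z3) = 0"
proof -
  have cramer: "a * (p1 * (q2 * r3 - q3 * r2) - q1 * (p2 * r3 - p3 * r2) + r1 * (p2 * q3 - p3 * q2)) = 0"
    if "a * p1 + b * q1 + c * r1 = 0" "a * p2 + b * q2 + c * r2 = 0" "a * p3 + b * q3 + c * r3 = 0"
    for p1 q1 r1 p2 q2 r2 p3 q3 r3 :: 'a
    using that by algebra
  have "a * of_int (x1 * (y2 * z3 - y3 * z2) - y1 * (x2 * z3 - x3 * z2) + z1 * (x2 * y3 - x3 * y2)) = 0"
    using cramer[OF assms(2-4)] by simp
  then show ?thesis using assms(1) unfolding det3_def by (simp only: mult_eq_0_iff of_int_eq_0_iff prod.case) (simp add: algebra_simps)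
qed

lemma ap_search:
  assumes "N = 2 \<or> N = 3" "length k = 4" "length l = 4" "length m = 4"
    and "sum_list k = N" "sum_list l = N" "sum_list m \<le> N"
    and "disjoint_exps k l" "partition_exps k l m" "ap_dependent k l m"
  shows "m = [0, 0, 0, 0]"
    and "k = [1, 0, 0, 1] \<and> l = [0, 1, 1, 0] \<or> k = [0, 1, 1, 0] \<and> l = [1, 0, 0, 1]"
proof -
  have "ap_patterns_ok (filter (sum_eq N) (exps 4 N)) (exps 4 N)"
    using assms(1) ap_patterns_degree_2 ap_patterns_degree_3 by blast
  moreover have "k \<in> set (filter (sum_eq N) (exps 4 N))" "l \<in> set (filter (sum_eq N) (exps 4 N))"
    "m \<in> set (exps 4 N)"
    using assms by (simp_all add: set_exps sum_eq_def)
  ultimately have "ap_pattern_ok k l m"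
    using assms(8,9) unfolding ap_patterns_ok_def ap_patterns_ok_first_def ap_patterns_ok_two_def list_all_iff by simp
  then show "m = [0, 0, 0, 0]"
    and "k = [1, 0, 0, 1] \<and> l = [0, 1, 1, 0] \<or> k = [0, 1, 1, 0] \<and> l = [1, 0, 0, 1]"
    using assms(10) unfolding ap_pattern_ok_def by blast+
qed

text \<open>Up to scalars the three polynomials are given by multiplicity lists. Disjointness and
  covering of the roots become conditions on these lists, the linear relation becomes vanishing
  determinants, and \<open>ap_search\<close> decides the rest.\<close>

lemma ap_pencil:
  fixes A B C :: "'a::{alg_closed_field, field_char_0} poly"
  assumes "A \<noteq> 0" "B \<noteq> 0" "C \<noteq> 0" "e \<noteq> 0"
    and C: "C = smult \<alpha> A + smult \<beta> B" and \<alpha>: "\<alpha> \<noteq> 0"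
    and no_common: "\<And>x. poly A x = 0 \<Longrightarrow> poly B x \<noteq> 0" "\<And>x. poly A x = 0 \<Longrightarrow> poly C x \<noteq> 0"
      "\<And>x. poly B x = 0 \<Longrightarrow> poly C x \<noteq> 0"
    and roots: "{x. poly A x = 0} \<union> {x. poly B x = 0} \<union> {x. poly C x = 0} =
      {a, a + e, a + 2 * e, a + 3 * e}"
    and degs: "degree A = N" "degree B = N" "degree C \<le> N" "N = 2 \<or> N = 3"
  shows "\<exists>c1 c2 c3. c1 \<noteq> 0 \<and> c2 \<noteq> 0 \<and> c3 \<noteq> 0 \<and> C = [:c3:] \<and>
    (A = smult c1 ([:-a, 1:] * [:-(a + 3 * e), 1:]) \<and>
       B = smult c2 ([:-(a + e), 1:] * [:-(a + 2 * e), 1:]) \<or>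
     B = smult c2 ([:-a, 1:] * [:-(a + 3 * e), 1:]) \<and>
       A = smult c1 ([:-(a + e), 1:] * [:-(a + 2 * e), 1:]))"
proof -
  obtain c1 k where k: "c1 \<noteq> 0" "length k = 4" and A: "A = smult c1 (ap_poly a e k)"
    using ap_poly_exists[of A e a] assms by blast
  obtain c2 l where l: "c2 \<noteq> 0" "length l = 4" and B: "B = smult c2 (ap_poly a e l)"
    using ap_poly_exists[of B e a] assms by blast
  obtain c3 m where m: "c3 \<noteq> 0" "length m = 4" and C': "C = smult c3 (ap_poly a e m)"
    using ap_poly_exists[of C e a] assms by blast
  have sums: "sum_list k = N" "sum_list l = N" "sum_list m \<le> N"
    using degs k l m unfolding A B C' by (auto simp: degree_ap_poly)
  have root_iff: "poly A (a + of_nat i * e) = 0 \<longleftrightarrow> k ! i > 0"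
      "poly B (a + of_nat i * e) = 0 \<longleftrightarrow> l ! i > 0"
      "poly C (a + of_nat i * e) = 0 \<longleftrightarrow> m ! i > 0" if "i \<in> {0, 1, 2, 3}" for i
    using ap_poly_eq_0_iff[OF k(2) assms(4) that] ap_poly_eq_0_iff[OF l(2) assms(4) that]
      ap_poly_eq_0_iff[OF m(2) assms(4) that] k(1) l(1) m(1) unfolding A B C' by simp_all
  have part: "(k ! i = 0 \<or> l ! i = 0) \<and> (k ! i + l ! i = 0 \<longleftrightarrow> m ! i > 0)" if i: "i \<in> {0, 1, 2, 3}" for i
  proof -
    have "a + of_nat i * e \<in> {a, a + e, a + 2 * e, a + 3 * e}" using i by auto
    then have "a + of_nat i * e \<in> {x. poly A x = 0} \<union> {x. poly B x = 0} \<union> {x. poly C x = 0}"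
      unfolding roots .
    then show ?thesis
      using root_iff[OF i] no_common[of "a + of_nat i * e"] by auto
  qed
  have all_less_4: "\<forall>i < 4. P i" if "P 0" "P 1" "P 2" "P 3" for P :: "nat \<Rightarrow> bool"
    using that by (simp add: numeral_eq_Suc All_less_Suc)
  have "\<forall>i < 4. (k ! i = 0 \<or> l ! i = 0) \<and> (k ! i + l ! i = 0 \<longleftrightarrow> m ! i > 0)"
    by (rule all_less_4) (rule part; simp)+
  then have "disjoint_exps k l" "partition_exps k l m"
    using k(2) l(2) m(2)
    unfolding disjoint_exps_def partition_exps_def list_all2_conv_all_nth by simp_all
  moreover have "ap_dependent k l m"
  proof -
    \<comment> \<open>The coefficients do not depend on \<open>x\<close>, so they form one kernel
      vector for every choice of three points.\<close>
    have "(\<alpha> * c1 * e ^ sum_list k) * of_int (ap_value k x) + (\<beta> * c2 * e ^ sum_list l) * of_int (ap_value l x)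
       + (- c3 * e ^ sum_list m) * of_int (ap_value m x) = 0" for x
    proof -
      have "poly C (a + of_int x * e) = \<alpha> * poly A (a + of_int x * e) + \<beta> * poly B (a + of_int x * e)"
        unfolding C by simp
      then show ?thesis
        unfolding A B C' poly_smult poly_ap_poly[OF k(2)] poly_ap_poly[OF l(2)] poly_ap_poly[OF m(2)]
        by (simp add: algebra_simps)
    qed
    moreover have "\<alpha> * c1 * e ^ sum_list k \<noteq> 0" using \<alpha> k(1) assms(4) by simp
    ultimately show ?thesis
      unfolding ap_dependent_def Let_def by (intro conjI; intro linear_dependence_det3; blast)
  qed
  ultimately have "m = [0, 0, 0, 0]"
    "k = [1, 0, 0, 1] \<and> l = [0, 1, 1, 0] \<or> k = [0, 1, 1, 0] \<and> l = [1, 0, 0, 1]"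
    using ap_search[OF degs(4) k(2) l(2) m(2) sums] by blast+
  moreover have "ap_poly a e [1, 0, 0, 1] = [:-a, 1:] * [:-(a + 3 * e), 1:]"
    "ap_poly a e [0, 1, 1, 0] = [:-(a + e), 1:] * [:-(a + 2 * e), 1:]"
    "smult c3 (ap_poly a e [0, 0, 0, 0]) = [:c3:]"
    by (simp_all add: ap_poly_def)
  ultimately show ?thesis
    using k(1) l(1) m(1) A B C' by metis
qed

subsection \<open>Pencils of polynomials\<close>

text \<open>The pair (1, x) yields p - x q, and (0, -1), the point at infinity, yields
  \<open>q\<close>.\<close>

definition pencil :: "'a::field poly \<Rightarrow> 'a poly \<Rightarrow> 'a \<times> 'a \<Rightarrow> 'a poly" where
  "pencil p q s = smult (fst s) p - smult (snd s) q"

text \<open>Pairs are not normalised, so distinctness of projective points is a nonzero 2 x 2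
  determinant; it also excludes (0, 0).\<close>

definition proj_distinct :: "'a::field \<times> 'a \<Rightarrow> 'a \<times> 'a \<Rightarrow> bool" where
  "proj_distinct s t \<longleftrightarrow> fst s * snd t \<noteq> fst t * snd s"

lemma proj_distinct_sym: "proj_distinct s t \<Longrightarrow> proj_distinct t s"
  by (auto simp: proj_distinct_def)

text \<open>Cramer's rule writes \<open>w\<close> as a combination of \<open>s\<close> and
  \<open>t\<close>; the coefficients are quotients of determinants that are nonzero by the
  assumptions.\<close>

lemma pencil_relation:
  assumes "proj_distinct s t" "proj_distinct w s" "proj_distinct w t"
  obtains a b where "a \<noteq> 0" "b \<noteq> 0" "pencil p q w = smult a (pencil p q s) + smult b (pencil p q t)"
proof -
  define D where "D = fst s * snd t - fst t * snd s"
  define a where "a = (fst w * snd t - fst t * snd w) / D"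
  define b where "b = (fst s * snd w - fst w * snd s) / D"
  have "D \<noteq> 0" "a \<noteq> 0" "b \<noteq> 0"
    using assms by (auto simp: D_def a_def b_def proj_distinct_def algebra_simps)
  have D_a: "D * a = fst w * snd t - fst t * snd w" and D_b: "D * b = fst s * snd w - fst w * snd s"
    using \<open>D \<noteq> 0\<close> unfolding a_def b_def by simp_all
  have "D * fst w = D * a * fst s + D * b * fst t" "D * snd w = D * a * snd s + D * b * snd t"
    unfolding D_a D_b by (simp_all add: D_def algebra_simps)
  then have *: "fst w = a * fst s + b * fst t" "snd w = a * snd s + b * snd t"
    using \<open>D \<noteq> 0\<close> by (simp_all add: mult.assoc flip: distrib_left)
  have "pencil p q w = smult a (pencil p q s) + smult b (pencil p q t)"
    unfolding pencil_def * by (simp add: smult_diff_right smult_add_left)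
  then show ?thesis using that \<open>a \<noteq> 0\<close> \<open>b \<noteq> 0\<close> by blast
qed

text \<open>Two distinct members span the same space as \<open>p\<close> and \<open>q\<close>, so
  common roots and degrees can be read off from any two of them.\<close>

lemma pencil_recover:
  assumes "proj_distinct s t"
  obtains a b c d where "p = smult a (pencil p q s) + smult b (pencil p q t)"
    "q = smult c (pencil p q s) + smult d (pencil p q t)"
proof -
  define D where "D = fst s * snd t - fst t * snd s"
  have D: "D \<noteq> 0" using assms by (simp add: D_def proj_distinct_def)
  have "smult D p = smult (snd t) (pencil p q s) + smult (- snd s) (pencil p q t)"
    "smult D q = smult (fst t) (pencil p q s) + smult (- fst s) (pencil p q t)"
    unfolding D_def pencil_def
    by (simp_all add: smult_diff_right smult_diff_left algebra_simps)
  then have "p = smult (inverse D) (smult (snd t) (pencil p q s) + smult (- snd s) (pencil p q t))"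
    "q = smult (inverse D) (smult (fst t) (pencil p q s) + smult (- fst s) (pencil p q t))"
    using D by (metis left_inverse smult_smult smult_1_left)+
  then show ?thesis
    using that[of "inverse D * snd t" "inverse D * - snd s" "inverse D * fst t" "inverse D * - fst s"]
    by (simp only: smult_add_right smult_smult)
qed

lemma pencil_no_common_root:
  fixes p q :: "'a::alg_closed_field poly"
  assumes "coprime p q" "proj_distinct s t" "poly (pencil p q s) x = 0"
  shows "poly (pencil p q t) x \<noteq> 0"
proof
  assume t: "poly (pencil p q t) x = 0"
  obtain a b c d where "p = smult a (pencil p q s) + smult b (pencil p q t)"
    "q = smult c (pencil p q s) + smult d (pencil p q t)" using pencil_recover[OF assms(2)] by blast
  then have "poly p x = 0 \<and> poly q x = 0"
    using assms(3) t by (metis add_0 mult_zero_right poly_add poly_smult)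
  then show False using assms(1) coprime_iff_no_common_root by blast
qed

lemma degree_pencil_le: "degree (pencil p q s) \<le> max (degree p) (degree q)"
  unfolding pencil_def
  by (intro degree_diff_le order.trans[OF degree_smult_le]) simp_all

text \<open>Both pairs span the same space. Consequently at most one of several distinct members
  falls below the full degree.\<close>

lemma degree_pencil_max:
  assumes "proj_distinct s t"
  shows "max (degree (pencil p q s)) (degree (pencil p q t)) = max (degree p) (degree q)"
proof -
  obtain a b c d where "p = smult a (pencil p q s) + smult b (pencil p q t)"
    "q = smult c (pencil p q s) + smult d (pencil p q t)" using pencil_recover[OF assms] by blast
  moreover have "degree (smult x A + smult y B) \<le> max (degree A) (degree B)" for x y and A B :: "'a poly"
    by (intro degree_add_le order.trans[OF degree_smult_le]) simp_all
  ultimately have "max (degree p) (degree q) \<le> max (degree (pencil p q s)) (degree (pencil p q t))"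
    by (metis max.boundedI)
  then show ?thesis using degree_pencil_le[of p q s] degree_pencil_le[of p q t] by (intro antisym) simp_all
qed

text \<open>If one member vanished, another would have positive degree, and any root of it would be
  a common root.\<close>

lemma pencil_nonzero:
  fixes p q :: "'a::alg_closed_field poly"
  assumes "coprime p q" "proj_distinct s t" "max (degree p) (degree q) > 0"
  shows "pencil p q s \<noteq> 0"
proof
  assume s: "pencil p q s = 0"
  then have "degree (pencil p q t) > 0" using degree_pencil_max[OF assms(2), of p q] assms(3) by simp
  then obtain x where "poly (pencil p q t) x = 0" using alg_closed_imp_poly_has_root by blast
  then show False using pencil_no_common_root[OF assms(1,2), of x] s by simp
qed

lemma pencil_cofactor:
  fixes p q D :: "'a::{alg_closed_field, field_char_0} poly"
  assumes "coprime p q" "proj_distinct s t" "max (degree p) (degree q) > 0" "degree D > 0"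
    and roots: "\<And>w x. w \<in> S \<Longrightarrow> poly (pencil p q w) x = 0 \<Longrightarrow> poly D x = 0"
    and "s \<in> S" "t \<in> S"
  obtains Z where "Z \<noteq> 0" "degree Z < degree D"
    "\<And>w. w \<in> S \<Longrightarrow> proj_distinct w s \<Longrightarrow> proj_distinct w t \<Longrightarrow> pencil p q w dvd Z"
proof -
  have "coprime (pencil p q s) (pencil p q t)"
    using pencil_no_common_root[OF assms(1,2)] coprime_iff_no_common_root by blast
  moreover have "pencil p q s \<noteq> 0" "pencil p q t \<noteq> 0"
    using pencil_nonzero[OF assms(1)] assms(2,3) proj_distinct_sym by blast+
  moreover have "degree (pencil p q s) > 0 \<or> degree (pencil p q t) > 0"
    using degree_pencil_max[OF assms(2), of p q] assms(3) by (metis less_max_iff_disj)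
  ultimately obtain Z where Z: "Z \<noteq> 0" "degree Z < degree D"
    "\<And>C a b. C = smult a (pencil p q s) + smult b (pencil p q t) \<Longrightarrow> a \<noteq> 0 \<Longrightarrow> b \<noteq> 0 \<Longrightarrow> C \<noteq> 0 \<Longrightarrow>
       (\<And>x. poly C x = 0 \<Longrightarrow> poly D x = 0) \<Longrightarrow> C dvd Z"
    using wronskian_cofactor[OF _ _ _ _ assms(4)] roots[OF assms(6)] roots[OF assms(7)] by metis
  have "pencil p q w dvd Z" if w: "w \<in> S" "proj_distinct w s" "proj_distinct w t" for w
  proof -
    obtain a b where ab: "a \<noteq> 0" "b \<noteq> 0" "pencil p q w = smult a (pencil p q s) + smult b (pencil p q t)"
      using pencil_relation[OF assms(2) w(2,3)] by metis
    have "pencil p q w \<noteq> 0" using pencil_nonzero[OF assms(1) w(2) assms(3)] .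
    then show ?thesis using Z(3)[OF ab(3,1,2)] roots[OF w(1)] by blast
  qed
  with Z(1,2) show ?thesis by (rule that)
qed

lemma pencil_ap:
  fixes p q :: "'a::{alg_closed_field, field_char_0} poly"
  assumes cop: "coprime p q" and N: "max (degree p) (degree q) \<ge> 2"
    and S: "finite S" "card S \<ge> 3"
    and dist: "\<And>s t. s \<in> S \<Longrightarrow> t \<in> S \<Longrightarrow> s \<noteq> t \<Longrightarrow> proj_distinct s t"
    and "e \<noteq> 0"
    and roots: "{x. \<exists>s\<in>S. poly (pencil p q s) x = 0} = {a, a + e, a + 2 * e, a + 3 * e}"
  shows "\<exists>s t w c1 c2 c3. S = {s, t, w} \<and> s \<noteq> t \<and> s \<noteq> w \<and> t \<noteq> w \<and> c1 \<noteq> 0 \<and> c2 \<noteq> 0 \<and> c3 \<noteq> 0 \<and>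
    pencil p q s = smult c1 ([:-a, 1:] * [:-(a + 3 * e), 1:]) \<and>
    pencil p q t = smult c2 ([:-(a + e), 1:] * [:-(a + 2 * e), 1:]) \<and> pencil p q w = [:c3:]"
proof -
  let ?A = "pencil p q"
  define N where "N = max (degree p) (degree q)"
  have N2: "N \<ge> 2" and Npos: "max (degree p) (degree q) > 0" using N by (auto simp: N_def)
  \<comment> \<open>\<open>D\<close> has the four points as simple roots; its degree 4 is what
    bounds every cofactor by degree 3.\<close>
  define D where "D = ap_poly a e [1, 1, 1, 1]"
  have degD: "degree D = 4" by (simp add: D_def degree_ap_poly)
  have D0: "poly D x = 0" if "w \<in> S" "poly (?A w) x = 0" for w x
  proof -
    have "x \<in> {a, a + e, a + 2 * e, a + 3 * e}" using that roots by blast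
    then show ?thesis unfolding D_def ap_poly_def poly_mult poly_power by auto
  qed
  have cofactor: "\<exists>Z. Z \<noteq> 0 \<and> degree Z \<le> 3 \<and> (\<forall>w\<in>S - {s, t}. ?A w dvd Z)"
    if st: "s \<in> S" "t \<in> S" "s \<noteq> t" for s t
  proof -
    have "degree D > 0" using degD by simp
    then obtain Z where "Z \<noteq> 0" "degree Z < degree D"
      "\<And>w. w \<in> S \<Longrightarrow> proj_distinct w s \<Longrightarrow> proj_distinct w t \<Longrightarrow> ?A w dvd Z"
      by (rule pencil_cofactor[of p q s t D S, rotated 3])
        (use cop dist st Npos D0 in blast)+
    then show ?thesis using dist st degD by (intro exI[of _ Z]) auto
  qed
  have full: "degree (?A s) = N \<or> degree (?A t) = N" if "s \<in> S" "t \<in> S" "s \<noteq> t" for s t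
    using degree_pencil_max[OF dist[OF that], of p q] unfolding N_def by (metis max_def)
  have nz: "?A s \<noteq> 0" if "s \<in> S" "t \<in> S" "s \<noteq> t" for s t
    using pencil_nonzero[OF cop dist[OF that] Npos] .
  obtain T where "T \<subseteq> S" "card T = 3" using S(2) obtain_subset_with_card_n by metis
  then obtain s0 t0 w0 where "s0 \<in> S" "t0 \<in> S" "w0 \<in> S" "s0 \<noteq> t0" "s0 \<noteq> w0" "t0 \<noteq> w0"
    by (auto simp: card_3_iff)
  \<comment> \<open>Of three members at most one drops in degree; it is named
    \<open>w\<close>.\<close>
  then obtain s t w where st: "s \<in> S" "t \<in> S" "w \<in> S" "s \<noteq> t" "s \<noteq> w" "t \<noteq> w"
    and deg: "degree (?A s) = N" "degree (?A t) = N"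
    using full by metis
  have S_eq: "S = {s, t, w}"
  proof (rule ccontr)
    assume "S \<noteq> {s, t, w}"
    then obtain w' where w': "w' \<in> S" "w' \<noteq> s" "w' \<noteq> t" "w' \<noteq> w" using st by blast
    \<comment> \<open>For the same reason one of \<open>w\<close> and \<open>w'\<close> has full
      degree; call it \<open>v\<close> and the other \<open>v'\<close>.\<close>
    obtain v v' where v: "v \<in> S" "v' \<in> S" "v \<noteq> s" "v \<noteq> t" "v' \<noteq> s" "v' \<noteq> t" "v \<noteq> v'" "degree (?A v) = N"
      using full[OF st(3) w'(1)] w' st by metis
    \<comment> \<open>Forming the cofactor from \<open>s\<close> and \<open>v'\<close> leaves the
      coprime full-degree members of \<open>t\<close> and \<open>v\<close> as divisors of
      \<open>Z\<close>, so 2 N would be at most 3.\<close>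
    obtain Z where Z: "Z \<noteq> 0" "degree Z \<le> 3" "\<forall>w\<in>S - {s, v'}. ?A w dvd Z"
      using cofactor[of s v'] st v by metis
    have "coprime (?A t) (?A v)"
      using pencil_no_common_root[OF cop dist[OF st(2) v(1)]] v coprime_iff_no_common_root by metis
    moreover have "?A v \<noteq> 0" "?A t \<noteq> 0" using nz v st by metis+
    ultimately have "?A t * ?A v dvd Z" using Z(3) st v by (intro coprime_mult_dvd) auto
    then have "degree (?A t * ?A v) \<le> 3" using Z(1,2) dvd_imp_degree_le order.trans by blast
    then show False
      using deg(2) v(8) N2 \<open>?A v \<noteq> 0\<close> \<open>?A t \<noteq> 0\<close> by (simp add: degree_mult_eq)
  qed
  have "N \<le> 3"
  proof -
    \<comment> \<open>Forming the cofactor from \<open>t\<close> and \<open>w\<close> leaves the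
      member of \<open>s\<close>, of degree N, as a divisor of \<open>Z\<close>.\<close>
    obtain Z where Z: "Z \<noteq> 0" "degree Z \<le> 3" "\<forall>v\<in>S - {t, w}. ?A v dvd Z"
      using cofactor[of t w] st by metis
    then have "degree (?A s) \<le> degree Z" using st by (intro dvd_imp_degree_le) auto
    then show ?thesis using deg Z(2) by simp
  qed
  then have N23: "N = 2 \<or> N = 3" using N2 by auto
  obtain \<alpha> \<beta> where rel: "\<alpha> \<noteq> 0" "?A w = smult \<alpha> (?A s) + smult \<beta> (?A t)"
    using pencil_relation[of s t w p q] dist st by metis
  have nzs: "?A s \<noteq> 0" "?A t \<noteq> 0" "?A w \<noteq> 0" using nz st by metis+
  have nc: "\<And>x. poly (?A s) x = 0 \<Longrightarrow> poly (?A t) x \<noteq> 0" "\<And>x. poly (?A s) x = 0 \<Longrightarrow> poly (?A w) x \<noteq> 0"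
    "\<And>x. poly (?A t) x = 0 \<Longrightarrow> poly (?A w) x \<noteq> 0"
    using pencil_no_common_root[OF cop] dist st by blast+
  have un: "{x. poly (?A s) x = 0} \<union> {x. poly (?A t) x = 0} \<union> {x. poly (?A w) x = 0} =
      {a, a + e, a + 2 * e, a + 3 * e}"
    using roots unfolding S_eq by auto
  have "degree (?A w) \<le> N" unfolding N_def by (rule degree_pencil_le)
  from ap_pencil[OF nzs \<open>e \<noteq> 0\<close> rel(2,1) nc un deg this N23]
  obtain c1 c2 c3 where c: "c1 \<noteq> 0" "c2 \<noteq> 0" "c3 \<noteq> 0" "?A w = [:c3:]"
    and or: "?A s = smult c1 ([:-a, 1:] * [:-(a + 3 * e), 1:]) \<and>
       ?A t = smult c2 ([:-(a + e), 1:] * [:-(a + 2 * e), 1:]) \<or>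
     ?A t = smult c2 ([:-a, 1:] * [:-(a + 3 * e), 1:]) \<and>
       ?A s = smult c1 ([:-(a + e), 1:] * [:-(a + 2 * e), 1:])" by blast
  from or show ?thesis
  proof
    assume "?A s = smult c1 ([:-a, 1:] * [:-(a + 3 * e), 1:]) \<and>
       ?A t = smult c2 ([:-(a + e), 1:] * [:-(a + 2 * e), 1:])"
    then show ?thesis using S_eq st c by blast
  next
    assume "?A t = smult c2 ([:-a, 1:] * [:-(a + 3 * e), 1:]) \<and>
       ?A s = smult c1 ([:-(a + e), 1:] * [:-(a + 2 * e), 1:])"
    moreover have "S = {t, s, w}" using S_eq by blast
    ultimately show ?thesis using st c by blast
  qed
qed

subsection \<open>Factorization of a composition\<close>

lemma Fract_1_mult: "Fract (p * q) 1 = Fract p 1 * Fract q (1::'a::field poly)"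
  by simp

lemma Fract_1_power: "Fract (p ^ n) 1 = Fract p (1::'a::field poly) ^ n"
  by (induction n) (simp_all add: One_fract_def Fract_1_mult del: mult_fract)

lemma Fract_1_prod: "Fract (\<Prod>x\<in>X. F x) 1 = (\<Prod>x\<in>X. Fract (F x) (1::'a::field poly))"
  by (induction X rule: infinite_finite_induct) (simp_all add: One_fract_def Fract_1_mult del: mult_fract)

lemma Fract_1_eq_0_iff [simp]: "Fract p 1 = 0 \<longleftrightarrow> p = (0::'a::field poly)"
  by (simp add: Zero_fract_def eq_fract)

lemma Fract_eq_divide: "q \<noteq> 0 \<Longrightarrow> Fract p q = Fract p 1 / Fract q (1::'a::field poly)"
  by (simp add: divide_fract)

lemma Fract_smult_1: "Fract (smult c p) 1 = rat_const c * Fract p 1"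
  by (simp add: rat_const_def)

lemma rat_const_mult: "rat_const (c * d) = rat_const c * rat_const d"
  by (simp add: rat_const_def mult.commute)

lemma rat_const_1 [simp]: "rat_const 1 = 1"
  by (simp add: rat_const_def One_fract_def one_pCons)

lemma rat_const_power: "rat_const (c ^ n) = rat_const c ^ n"
  by (induction n) (simp_all add: rat_const_mult)

lemma rat_const_divide: "d \<noteq> 0 \<Longrightarrow> rat_const (c / d) = rat_const c / rat_const d"
  by (metis nonzero_eq_divide_eq rat_const_eq_0_iff rat_const_mult)

lemma rat_const_inverse: "rat_const (inverse c) = inverse (rat_const c)"
proof (cases "c = 0")
  case False
  then show ?thesis using rat_const_divide[of c 1] by (simp add: inverse_eq_divide)
qed simp

lemma rat_const_powi: "rat_const (c powi n) = rat_const c powi n"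
  by (simp add: power_int_def rat_const_power rat_const_inverse)

lemma rat_const_add: "rat_const (c + d) = rat_const c + rat_const d"
  by (simp add: rat_const_def)

lemma poly_at_rat_pCons: "poly_at_rat (pCons c p) h = rat_const c + h * poly_at_rat p h"
  by (simp add: poly_at_rat_def map_poly_pCons)

lemma poly_at_rat_0 [simp]: "poly_at_rat 0 h = 0"
  by (simp add: poly_at_rat_def)

lemma poly_at_rat_add: "poly_at_rat (p + q) h = poly_at_rat p h + poly_at_rat q h"
  by (induction p q rule: poly_induct2) (simp_all add: poly_at_rat_pCons rat_const_add algebra_simps)

lemma poly_at_rat_mult: "poly_at_rat (p * q) h = poly_at_rat p h * poly_at_rat q h"
  by (induction p) (simp_all add: poly_at_rat_pCons poly_at_rat_add poly_at_rat_smult algebra_simps)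

lemma poly_at_rat_1 [simp]: "poly_at_rat 1 h = 1"
  by (simp add: one_pCons poly_at_rat_pCons)

lemma poly_at_rat_power: "poly_at_rat (p ^ n) h = poly_at_rat p h ^ n"
  by (induction n) (simp_all add: poly_at_rat_mult)

lemma poly_at_rat_prod: "poly_at_rat (\<Prod>x\<in>X. F x) h = (\<Prod>x\<in>X. poly_at_rat (F x) h)"
  by (induction X rule: infinite_finite_induct) (simp_all add: poly_at_rat_mult)

lemma poly_at_rat_X: "poly_at_rat p (Fract [:0, 1:] 1) = Fract p 1"
  by (induction p) (simp_all add: poly_at_rat_pCons rat_const_def Zero_fract_def)

text \<open>With the identity as inner function, the factorization of compositions also describes
  \<open>g\<close> itself.\<close>

lemma rat_compose_X: "rat_compose g (Fract [:0, 1:] 1) = g"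
proof -
  obtain p q where pq: "lowest_terms g p q" using lowest_terms_exists by blast
  then have "rat_compose g (Fract [:0, 1:] 1) = Fract p 1 / Fract q 1"
    by (simp only: rat_compose_eq poly_at_rat_X)
  also have "\<dots> = g" using pq by (simp add: lowest_terms_def divide_fract)
  finally show ?thesis .
qed

lemma poly_at_rat_linear:
  assumes "q \<noteq> 0"
  shows "poly_at_rat [:-x, 1:] (Fract p q) = Fract (pencil p q (1, x)) 1 / Fract q 1"
  using assms by (simp add: poly_at_rat_pCons rat_const_def pencil_def divide_fract)

lemma power_diff_powi:
  "(x::'a::field) \<noteq> 0 \<Longrightarrow> x ^ k / x ^ l = x powi (int k - int l)"
  by (simp add: power_int_diff)

lemma prod_powi_sum:
  fixes y :: "'a::field"
  shows "y \<noteq> 0 \<Longrightarrow> (\<Prod>x\<in>X. y powi n x) = y powi sum n X"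
  by (induction X rule: infinite_finite_induct) (simp_all add: power_int_add)

text \<open>\<open>S\<close>, \<open>m\<close> and \<open>c\<close> are chosen before
  \<open>p\<close> and \<open>q\<close>, so the same data describe \<open>g\<close> and its
  composition with \<open>h\<close>. Counting infinity among the points makes the multiplicities sum
  to 0.\<close>

lemma rat_compose_factorization:
  fixes g :: "'a::alg_closed_field poly fract"
  assumes "g \<noteq> 0"
  obtains S m c where "finite S" "c \<noteq> 0" "\<And>s. s \<in> S \<Longrightarrow> m s \<noteq> 0" "sum m S = 0"
    "\<And>s t. s \<in> S \<Longrightarrow> t \<in> S \<Longrightarrow> s \<noteq> t \<Longrightarrow> proj_distinct s t"
    "\<And>s. s \<in> S \<Longrightarrow> s \<noteq> (0, 0)"
    "\<And>p q. q \<noteq> 0 \<Longrightarrow> (\<And>s. s \<in> S \<Longrightarrow> pencil p q s \<noteq> 0) \<Longrightarrow>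
       rat_compose g (Fract p q) = rat_const c * (\<Prod>s\<in>S. Fract (pencil p q s) 1 powi m s)"
proof -
  obtain P Q where PQ: "lowest_terms g P Q" using lowest_terms_exists by blast
  then have nz: "P \<noteq> 0" "Q \<noteq> 0" and cop: "coprime P Q"
    using assms by (auto simp: lowest_terms_def Zero_fract_def eq_fract)
  define X where "X = {x. poly P x = 0} \<union> {x. poly Q x = 0}"
  have fin: "finite X" using nz by (simp add: X_def poly_roots_finite)
  obtain k c1 where P: "c1 \<noteq> 0" "P = smult c1 (\<Prod>x\<in>X. [:-x, 1:] ^ k x)"
    using poly_splits_on[OF nz(1) fin] X_def by blast
  obtain l c2 where Q: "c2 \<noteq> 0" "Q = smult c2 (\<Prod>x\<in>X. [:-x, 1:] ^ l x)"
    using poly_splits_on[OF nz(2) fin] X_def by blast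
  have ex: "int (k x) - int (l x) \<noteq> 0" if "x \<in> X" for x
  proof -
    have "poly P x = 0 \<longleftrightarrow> k x > 0" "poly Q x = 0 \<longleftrightarrow> l x > 0"
      using that fin P Q by (auto simp: poly_prod poly_power)
    moreover have "(poly P x = 0) \<noteq> (poly Q x = 0)"
      using that cop coprime_iff_no_common_root unfolding X_def by blast
    ultimately show ?thesis by auto
  qed
  define n where "n x = int (k x) - int (l x)" for x
  \<comment> \<open>(0, -1) is the point at infinity; it is a zero or pole unless the finite orders sum to 0.\<close>
  define S :: "('a \<times> 'a) set" where "S = Pair 1 ` X \<union> (if sum n X = 0 then {} else {(0, -1)})"
  define m where "m s = (if fst s = 0 then - sum n X else n (snd s))" for s :: "'a \<times> 'a"
  have prod_S: "prod F S = prod (\<lambda>x. F (1, x)) X * (if sum n X = 0 then 1 else F (0, -1))"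
    for F :: "'a \<times> 'a \<Rightarrow> 'a poly fract"
    using fin by (cases "sum n X = 0") (simp_all add: S_def prod.reindex inj_on_def image_iff mult.commute)
  show ?thesis
  proof (rule that[of S "c1 / c2" m])
    show "finite S" using fin by (simp add: S_def)
    show "c1 / c2 \<noteq> 0" using P Q by simp
    show "m s \<noteq> 0" if "s \<in> S" for s
      using that ex by (auto simp: S_def m_def n_def split: if_splits)
    have "sum m S = sum (\<lambda>x. m (1, x)) X + (if sum n X = 0 then 0 else m (0, -1))"
      using fin by (cases "sum n X = 0") (simp_all add: S_def sum.reindex inj_on_def image_iff)
    then show "sum m S = 0" by (simp add: m_def)
    show "proj_distinct s t" if "s \<in> S" "t \<in> S" "s \<noteq> t" for s t
      using that by (auto simp: S_def proj_distinct_def split: if_splits)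
    show "s \<noteq> (0, 0)" if "s \<in> S" for s
      using that by (auto simp: S_def split: if_splits)
    show "rat_compose g (Fract p q) = rat_const (c1 / c2) * (\<Prod>s\<in>S. Fract (pencil p q s) 1 powi m s)"
      if q: "q \<noteq> 0" and pen: "\<And>s. s \<in> S \<Longrightarrow> pencil p q s \<noteq> 0" for p q
    proof -
      let ?h = "Fract p q"
      let ?\<iota> = "\<lambda>p. Fract p 1"
      have lin: "poly_at_rat [:-x, 1:] ?h = ?\<iota> (pencil p q (1, x)) / ?\<iota> q" for x
        using q by (rule poly_at_rat_linear)
      have lin_nz: "poly_at_rat [:-x, 1:] ?h \<noteq> 0" if "x \<in> X" for x
        unfolding lin using q pen[of "(1, x)"] that by (simp add: S_def del: divide_fract)
      have "rat_compose g ?h = poly_at_rat P ?h / poly_at_rat Q ?h" by (rule rat_compose_eq[OF PQ])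
      also have "\<dots> = rat_const (c1 / c2) *
          (\<Prod>x\<in>X. poly_at_rat [:-x, 1:] ?h ^ k x / poly_at_rat [:-x, 1:] ?h ^ l x)"
        unfolding P(2) Q(2) poly_at_rat_smult poly_at_rat_prod poly_at_rat_power
          rat_const_divide[OF Q(1)] prod_dividef by simp
      also have "\<dots> = rat_const (c1 / c2) * (\<Prod>x\<in>X. (?\<iota> (pencil p q (1, x)) / ?\<iota> q) powi n x)"
        using lin_nz unfolding n_def by (simp add: power_diff_powi lin del: divide_fract cong: prod.cong)
      \<comment> \<open>The denominators \<open>q\<close> collect into one power, which is the
        factor belonging to the point at infinity.\<close>
      also have "\<dots> = rat_const (c1 / c2) *
          ((\<Prod>x\<in>X. ?\<iota> (pencil p q (1, x)) powi n x) * ?\<iota> q powi (- sum n X))"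
        using q by (simp add: power_int_divide_distrib prod_dividef power_int_minus prod_powi_sum
            del: divide_fract) (simp add: divide_inverse)
      also have "\<dots> = rat_const (c1 / c2) * (\<Prod>s\<in>S. ?\<iota> (pencil p q s) powi m s)"
        unfolding prod_S by (auto simp: m_def pencil_def)
      finally show ?thesis .
    qed
  qed
qed

section \<open>Counting zeros and poles on the projective line\<close>

lemma rat_degree_rat_const: "rat_degree (rat_const c) = 0"
proof -
  have "lowest_terms (rat_const c) [:c:] 1" by (simp add: lowest_terms_def rat_const_def)
  then show ?thesis by (simp add: rat_degree_eq)
qed

lemma pencil_X: "pencil [:0, 1:] 1 s = [:- snd s, fst s:]"
  by (simp add: pencil_def)

text \<open>Over an algebraically closed field the constant has an n-th root, which is absorbed into
  the fractional linear function.\<close>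

lemma rat_pencil_powi_is_linear_power:
  fixes s t :: "'a::alg_closed_field \<times> 'a"
  assumes "proj_distinct s t" "c \<noteq> 0" "n > 0"
  shows "\<exists>l. fractional_linear l \<and>
    rat_const c * (Fract (pencil [:0, 1:] 1 s) 1 powi n * Fract (pencil [:0, 1:] 1 t) 1 powi (- n)) = l ^ nat n"
proof -
  obtain d where d: "d ^ nat n = c" using nth_root_exists[of "nat n" c] assms(3) by auto
  then have "d \<noteq> 0" using assms(2,3) by auto
  define l where "l = Fract [:- d * snd s, d * fst s:] [:- snd t, fst t:]"
  have "(d * fst s) * (- snd t) - (- d * snd s) * fst t \<noteq> 0"
    using \<open>d \<noteq> 0\<close> assms(1) by (auto simp: proj_distinct_def algebra_simps)
  then have "fractional_linear l" unfolding fractional_linear_def l_def by blast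
  moreover have "l = rat_const d * Fract (pencil [:0, 1:] 1 s) 1 / Fract (pencil [:0, 1:] 1 t) 1"
    using assms(1) by (auto simp: l_def pencil_X rat_const_def proj_distinct_def mult.commute)
  moreover have "x powi n * y powi (- n) = (x / y) ^ nat n" for x y :: "'a poly fract"
    using assms(3) by (simp add: power_int_def power_divide divide_inverse power_mult_distrib power_inverse)
  moreover have "rat_const c = rat_const d ^ nat n" using d by (simp only: flip: rat_const_power)
  ultimately show ?thesis
    by (intro exI[of _ l]) (simp only: power_mult_distrib flip: times_divide_eq_right)
qed

text \<open>Without points \<open>g\<close> is constant; a single point would have multiplicity 0;
  two points have opposite multiplicities and make \<open>g\<close> a power of a fractional linear
  function.\<close>

lemma three_zeros_or_poles:
  fixes g :: "'a::alg_closed_field poly fract"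
  assumes "rat_degree g \<ge> 2" "\<not> (\<exists>l (m::nat). fractional_linear l \<and> g = l ^ m)"
    and S: "finite S" "c \<noteq> 0" "\<And>s. s \<in> S \<Longrightarrow> m s \<noteq> 0" "sum m S = 0"
      "\<And>s t. s \<in> S \<Longrightarrow> t \<in> S \<Longrightarrow> s \<noteq> t \<Longrightarrow> proj_distinct s t"
    and g: "g = rat_const c * (\<Prod>s\<in>S. Fract (pencil [:0, 1:] 1 s) 1 powi (m s :: int))"
  shows "card S \<ge> 3"
proof (rule ccontr)
  assume "\<not> card S \<ge> 3"
  then consider "card S = 0" | "card S = 1" | "card S = 2" by linarith
  then show False
  proof cases
    case 1
    then show False using S(1) g assms(1) by (simp add: rat_degree_rat_const)
  next
    case 2
    then show False using S(3,4) by (auto simp: card_1_singleton_iff)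
  next
    case 3
    then obtain s t where st: "S = {s, t}" "s \<noteq> t" by (auto simp: card_2_iff)
    have main: False if st: "S = {s, t}" "s \<noteq> t" "m s > 0" for s t
    proof -
      have "m t = - m s" using S(4) st by simp
      then have "g = rat_const c * (Fract (pencil [:0, 1:] 1 s) 1 powi m s *
          Fract (pencil [:0, 1:] 1 t) 1 powi (- m s))"
        using g st by simp
      then show False
        using rat_pencil_powi_is_linear_power[OF S(5) S(2) st(3), of s t] st assms(2) by auto
    qed
    have "m s + m t = 0" "m s \<noteq> 0" using S(3,4) st by auto
    then have "m s > 0 \<or> m t > 0" by linarith
    then show False using main[of s t] main[of t s] st by (auto simp: insert_commute)
  qed
qed

text \<open>Positive exponents go to the numerator, negative ones to the denominator. As no two
  factors share a root, nothing cancels.\<close>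

lemma rat_zeros_poles_prod:
  fixes A :: "'b \<Rightarrow> 'a::alg_closed_field poly"
  assumes "finite S" "c \<noteq> 0" and nz: "\<And>s. s \<in> S \<Longrightarrow> m s \<noteq> 0" "\<And>s. s \<in> S \<Longrightarrow> A s \<noteq> 0"
    and nc: "\<And>s t x. s \<in> S \<Longrightarrow> t \<in> S \<Longrightarrow> s \<noteq> t \<Longrightarrow> poly (A s) x = 0 \<Longrightarrow> poly (A t) x \<noteq> 0"
    and f: "f = rat_const c * (\<Prod>s\<in>S. Fract (A s) 1 powi (m s :: int))"
  shows "rat_zeros f \<union> rat_poles f = {x. \<exists>s\<in>S. poly (A s) x = 0}"
proof -
  define P where "P = smult c (\<Prod>s\<in>S. A s ^ nat (m s))"
  define Q where "Q = (\<Prod>s\<in>S. A s ^ nat (- m s))"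
  have P0: "poly P x = 0 \<longleftrightarrow> (\<exists>s\<in>S. m s > 0 \<and> poly (A s) x = 0)" for x
    using assms(1,2) by (auto simp: P_def poly_prod poly_power)
  have Q0: "poly Q x = 0 \<longleftrightarrow> (\<exists>s\<in>S. m s < 0 \<and> poly (A s) x = 0)" for x
    using assms(1) by (auto simp: Q_def poly_prod poly_power)
  have "coprime P Q" unfolding coprime_iff_no_common_root P0 Q0 using nc by (metis less_asym)
  moreover have "Q \<noteq> 0" using assms(1) nz by (simp add: Q_def)
  moreover have "f = Fract P Q"
  proof -
    have "x powi n = x ^ nat n / x ^ nat (- n)" for x :: "'a poly fract" and n
      by (cases "n \<ge> 0") (simp_all add: power_int_def divide_inverse power_inverse)
    then have "f = rat_const c * ((\<Prod>s\<in>S. Fract (A s) 1 ^ nat (m s)) / (\<Prod>s\<in>S. Fract (A s) 1 ^ nat (- m s)))"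
      unfolding f by (simp only: prod_dividef)
    also have "\<dots> = Fract P 1 / Fract Q 1"
      unfolding P_def Q_def Fract_smult_1 Fract_1_prod Fract_1_power by (simp only: times_divide_eq_right)
    finally show ?thesis using Fract_eq_divide[OF \<open>Q \<noteq> 0\<close>] by metis
  qed
  ultimately have "lowest_terms f P Q" by (simp add: lowest_terms_def)
  then have "rat_zeros f \<union> rat_poles f = {x. poly P x = 0 \<or> poly Q x = 0}"
    by (auto simp: rat_zeros_eq rat_poles_eq)
  moreover have "m s > 0 \<or> m s < 0" if "s \<in> S" for s using nz(1)[OF that] by linarith
  then have "{x. poly P x = 0 \<or> poly Q x = 0} = {x. \<exists>s\<in>S. poly (A s) x = 0}"
    unfolding P0 Q0 by blast
  ultimately show ?thesis by simp
qed

section \<open>Equivalence with the symmetric product\<close>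

lemma equivalent_refl_factorization:
  assumes "factorization n f \<alpha> m" "factorization n g \<alpha> m"
  shows "equivalent n f g"
  unfolding equivalent_def
proof (intro exI conjI ballI)
  fix u assume u: "u \<in> {1..n}"
  \<comment> \<open>The matrix is the identity with a zero translation column, because n + 1 never
    equals \<open>u\<close>.\<close>
  have "(\<Sum>v = 1..n. of_rat (if v = u then 1 else 0) * \<alpha> v) = (\<Sum>v = 1..n. if v = u then \<alpha> v else 0)"
    by (intro sum.cong) auto
  then show "\<alpha> u = (\<Sum>v = 1..n. of_rat (if v = u then 1 else 0) * \<alpha> v) +
      of_rat (if n + 1 = u then 1 else 0)"
    using u by simp
qed (use assms in auto)

theorem proposition1:
  fixes f g h :: "'a::{alg_closed_field, field_char_0} poly fract"
  assumes "f = rat_compose g h"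
    and "rat_degree g \<ge> 2"
    and "rat_degree h \<ge> 2"
    and "\<not> (\<exists>l (m::nat). fractional_linear l \<and> g = l ^ m)"
    and "card (rat_zeros f \<union> rat_poles f) = 4"
    and "\<exists>a e. rat_zeros f \<union> rat_poles f = {a, a + e, a + 2 * e, a + 3 * e}"
  shows "\<exists>(\<alpha>0::'a) (d::'a) (k1::int) (k2::int). k1 + k2 \<noteq> 0 \<and>
           equivalent 4 f
             (linear_factor \<alpha>0 powi k1 * linear_factor (\<alpha>0 + d) powi k2 *
              linear_factor (\<alpha>0 + 2 * d) powi k2 * linear_factor (\<alpha>0 + 3 * d) powi k1)"
proof -
  obtain a e where ap: "rat_zeros f \<union> rat_poles f = {a, a + e, a + 2 * e, a + 3 * e}"
    using assms(6) by blast
  have e: "e \<noteq> 0"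
  proof
    assume "e = 0"
    then show False using assms(5) unfolding ap by simp
  qed
  have "g \<noteq> 0" using assms(2) rat_degree_rat_const[of "0::'a"] by auto
  then obtain S m c where S: "finite S" "c \<noteq> 0" "\<And>s. s \<in> S \<Longrightarrow> m s \<noteq> 0" "sum m S = 0"
    "\<And>s t. s \<in> S \<Longrightarrow> t \<in> S \<Longrightarrow> s \<noteq> t \<Longrightarrow> proj_distinct s t"
    "\<And>s. s \<in> S \<Longrightarrow> s \<noteq> (0, 0)"
    and comp: "\<And>p q. q \<noteq> 0 \<Longrightarrow> (\<And>s. s \<in> S \<Longrightarrow> pencil p q s \<noteq> 0) \<Longrightarrow>
       rat_compose g (Fract p q) = rat_const c * (\<Prod>s\<in>S. Fract (pencil p q s) 1 powi m s)"
    by (rule rat_compose_factorization) blast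
  \<comment> \<open>The identity, as the fraction of \<open>[:0, 1:]\<close> and 1, takes the place
    of \<open>h\<close>.\<close>
  have "g = rat_const c * (\<Prod>s\<in>S. Fract (pencil [:0, 1:] 1 s) 1 powi m s)"
    using comp[of 1 "[:0, 1:]"] S(6) rat_compose_X[of g] by (auto simp: pencil_X prod_eq_iff)
  then have card: "card S \<ge> 3" using three_zeros_or_poles[OF assms(2,4) S(1-5)] by blast
  obtain p q where pq: "lowest_terms h p q" using lowest_terms_exists by blast
  then have q: "q \<noteq> 0" and cop: "coprime p q" and h: "h = Fract p q"
    by (simp_all add: lowest_terms_def)
  have N: "max (degree p) (degree q) \<ge> 2" using assms(3) rat_degree_eq[OF pq] by simp
  have pen: "pencil p q s \<noteq> 0" if "s \<in> S" for s
  proof -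
    have "S \<noteq> {s}" using card by auto
    then obtain t where "t \<in> S" "s \<noteq> t" using \<open>s \<in> S\<close> by blast
    then show ?thesis using pencil_nonzero[OF cop S(5)[OF that]] N by simp
  qed
  have f: "f = rat_const c * (\<Prod>s\<in>S. Fract (pencil p q s) 1 powi m s)"
    unfolding assms(1) h using comp[OF q pen] by blast
  have "rat_zeros f \<union> rat_poles f = {x. \<exists>s\<in>S. poly (pencil p q s) x = 0}"
    using rat_zeros_poles_prod[OF S(1-3) pen _ f] pencil_no_common_root[OF cop S(5)] by blast
  with ap have "{x. \<exists>s\<in>S. poly (pencil p q s) x = 0} = {a, a + e, a + 2 * e, a + 3 * e}" by simp
  from pencil_ap[OF cop N S(1) card S(5) e this]
  obtain s t w c1 c2 c3 where stw: "S = {s, t, w}" "s \<noteq> t" "s \<noteq> w" "t \<noteq> w"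
    and c: "c1 \<noteq> 0" "c2 \<noteq> 0" "c3 \<noteq> 0"
    and A: "pencil p q s = smult c1 ([:-a, 1:] * [:-(a + 3 * e), 1:])"
      "pencil p q t = smult c2 ([:-(a + e), 1:] * [:-(a + 2 * e), 1:])" "pencil p q w = [:c3:]"
    by blast
  define F where "F = linear_factor a powi m s * linear_factor (a + e) powi m t *
    linear_factor (a + 2 * e) powi m t * linear_factor (a + 3 * e) powi m s"
  \<comment> \<open>The constant member at \<open>w\<close> contributes only to the scalar
    \<open>K\<close>.\<close>
  define K where "K = c * (c1 powi m s * c2 powi m t * c3 powi m w)"
  have "K \<noteq> 0" using S(2) c by (simp add: K_def)
  have iota: "Fract (pencil p q s) 1 = rat_const c1 * (linear_factor a * linear_factor (a + 3 * e))"
    "Fract (pencil p q t) 1 = rat_const c2 * (linear_factor (a + e) * linear_factor (a + 2 * e))"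
    "Fract (pencil p q w) 1 = rat_const c3"
    unfolding A Fract_smult_1 Fract_1_mult linear_factor_def by (simp_all add: rat_const_def)
  have "f = rat_const c * (Fract (pencil p q s) 1 powi m s * (Fract (pencil p q t) 1 powi m t *
      Fract (pencil p q w) 1 powi m w))"
    unfolding f stw(1) using stw(2-4) by simp
  also have "\<dots> = rat_const K * F"
    unfolding iota K_def F_def by (simp add: power_int_mult_distrib rat_const_mult rat_const_powi mult_ac)
  finally have fK: "f = rat_const K * F" .
  \<comment> \<open>The exponents do not cancel because their sum is minus the nonzero multiplicity
    of \<open>w\<close>.\<close>
  have "m s + m t + m w = 0" using S(4) stw by simp
  then have ms: "m s \<noteq> 0" "m t \<noteq> 0" "m s + m t \<noteq> 0"
    using S(3)[of s] S(3)[of t] S(3)[of w] stw(1) by auto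
  define \<alpha> where "\<alpha> u = a + of_nat (u - 1) * e" for u :: nat
  define \<mu> where "\<mu> u = (if u = 1 \<or> u = 4 then m s else m t)" for u :: nat
  have "{1..4} = {1, 2, 3, 4::nat}" by auto
  then have prod: "(\<Prod>u = 1..4. linear_factor (\<alpha> u) powi \<mu> u) = F"
    by (simp add: \<alpha>_def \<mu>_def F_def mult_ac)
  have "inj_on \<alpha> {1..4}"
    using e by (auto simp: inj_on_def \<alpha>_def)
  then have "factorization 4 (rat_const k * F) \<alpha> \<mu>" if "k \<noteq> 0" for k
    using ms that unfolding factorization_def prod by (auto simp: \<mu>_def)
  \<comment> \<open>\<open>K\<close> gives the factorization of \<open>f\<close> and 1 that of
    \<open>F\<close>, with the same points and exponents.\<close>
  from this[of K] this[of 1] have "equivalent 4 f F"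
    using equivalent_refl_factorization \<open>K \<noteq> 0\<close> unfolding fK by simp blast
  then show ?thesis using ms(3) unfolding F_def by blast
qed

end
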